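(* Let $\boldsymbol{s}=(s_1,\ldots,s_n)$ and $\boldsymbol{t}=(t_1,\ldots,t_n)$ be vectors of nonnegative integers with $\sum_i s_i=\sum_i t_i=S$. Assume that $s_{\max}t_{\max}=o(S^{2/3})$ as $S\to\infty$ and $S=\Omega(n)$. Then the expected permanent of a uniformly random $n\times n$ 0-1 matrix with row sums $(n-s_1,\ldots,n-s_n)$ and column sums $(n-t_1,\ldots,n-t_n)$ is $$n!\,\exp\left(-\frac{S}{n}+O\left(\frac{s_{\max}^{3/2}t_{\max}^{3/2}}{S}\right)\right).$$
   Context: Notation: $s_{\max}=\max_i s_i$ and $t_{\max}=\max_i t_i$. Asymptotic convention: one considers an infinite family of instances $(n,\boldsymbol{s},\boldsymbol{t})$ along which $S\to\infty$; $o(\cdot)$ hypotheses refer to this limit; $S=\Omega(n)$ means $S\ge cn$ for some constant $c>0$ independent of the instance; and $O(g)$ denotes a quantity (of either sign) whose absolute value is at most a constant times $g$ for all sufficiently large $S$, uniformly over the family. *)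

theory Defs
  imports
    "HOL-Probability.Probability"
    "HOL-Library.Landau_Symbols"
    "Jordan_Normal_Form.Matrix"
begin

definition permanent :: "'a :: comm_semiring_1 mat \<Rightarrow> 'a" where
  "permanent A =
     (\<Sum>p | p permutes {0..<dim_row A}. \<Prod>i = 0..<dim_row A. A $$ (i, p i))"

text \<open>
  Margins are lists, so that their length may vary from instance to instance. The differences
  are taken in the reals: an entry exceeding \<open>n\<close> makes the set empty instead of being truncated.
\<close>

definition matrices_with_complementary_sums :: "nat \<Rightarrow> nat list \<Rightarrow> nat list \<Rightarrow> real mat set" where
  "matrices_with_complementary_sums n s t =
     {A \<in> carrier_mat n n.
        (\<forall>i<n. \<forall>j<n. A $$ (i, j) \<in> {0, 1}) \<and>
        (\<forall>i<n. (\<Sum>j<n. A $$ (i, j)) = real n - real (s ! i)) \<and>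
        (\<forall>j<n. (\<Sum>i<n. A $$ (i, j)) = real n - real (t ! j))}"

definition expected_permanent :: "nat \<Rightarrow> nat list \<Rightarrow> nat list \<Rightarrow> real" where
  "expected_permanent n s t =
     measure_pmf.expectation (pmf_of_set (matrices_with_complementary_sums n s t)) permanent"

end

theory Submission
  imports Defs
begin

text \<open>
  Averaging over the matrix is not needed: for every single matrix, with set \<open>B\<close> of zero cells,
  \<open>S = |B|\<close> and at most \<open>a\<close> (\<open>b\<close>) zeros in each row (column), the proportion of permutations
  avoiding \<open>B\<close> is \<open>exp (- S / n + O(S (a + b) / n\<^sup>2))\<close>. Indeed, when the cells of \<open>B\<close> are forbidden
  one at a time, transposition switchings show that a permutation avoiding the previous cells
  passes through the new one with probability \<open>1 / n + O((a + b) / n\<^sup>2)\<close>. Since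
  \<open>S / n \<le> min a b\<close>, the error is \<open>O((a b)\<^bsup>3/2\<^esup> / S)\<close>.
\<close>

section \<open>Permutations avoiding forbidden cells\<close>

definition avoiding :: "'a set \<Rightarrow> ('a \<times> 'a) set \<Rightarrow> ('a \<Rightarrow> 'a) set" where
  "avoiding V B = {p. p permutes V \<and> (\<forall>x\<in>V. (x, p x) \<notin> B)}"

lemma finite_avoiding: "finite V \<Longrightarrow> finite (avoiding V B)"
  unfolding avoiding_def by (rule finite_subset[OF _ finite_permutations[of V]]) auto

text \<open>Only the images of \<open>x\<close> and \<open>y\<close> change, so
  \<open>(x, p y)\<close> and \<open>(y, p x)\<close> are the only new cells to check.\<close>

lemma avoiding_compose_transpose:
  assumes "p \<in> avoiding V B" "x \<in> V" "y \<in> V" "(x, p y) \<notin> B" "(y, p x) \<notin> B"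
  shows "p \<circ> Transposition.transpose x y \<in> avoiding V B"
  using assms unfolding avoiding_def
  by (auto simp: Transposition.transpose_def intro!: permutes_compose permutes_swap_id)

text \<open>\<open>p\<close> maps these positions injectively into the forbidden columns of row
  \<open>x\<close>.\<close>

lemma card_row_le:
  assumes "finite V" "p permutes V" "card {y\<in>V. (x, y) \<in> B} \<le> a"
  shows "card {k\<in>V. (x, p k) \<in> B} \<le> a"
proof -
  have "card {k\<in>V. (x, p k) \<in> B} \<le> card {y\<in>V. (x, y) \<in> B}"
    using assms permutes_in_image[OF assms(2)] permutes_inj_on[OF assms(2)]
    by (intro card_inj_on_le[of p]) auto
  thus ?thesis using assms by simp
qed

section \<open>Switchings when every row and column has few forbidden cells\<close>

locale bounded_cells =
  fixes V :: "'a set" and B :: "('a \<times> 'a) set" and a b :: nat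
  assumes finite_V: "finite V"
    and row: "\<And>x. x \<in> V \<Longrightarrow> card {y\<in>V. (x, y) \<in> B} \<le> a"
    and col: "\<And>y. y \<in> V \<Longrightarrow> card {x\<in>V. (x, y) \<in> B} \<le> b"
begin

text \<open>
  Switching: from \<open>p\<close> with \<open>p i = j\<close>, exchange the images of \<open>i\<close> and of any \<open>k\<close> for which neither
  new cell is forbidden; \<open>k\<close> is recovered as the preimage of \<open>j\<close> (the choice \<open>k = i\<close> is allowed).
\<close>

lemma card_avoiding_through_upper:
  assumes ij: "i \<in> V" "j \<in> V" "(i, j) \<notin> B"
  shows "card {p \<in> avoiding V B. p i = j} * (card V - a - b) \<le> card (avoiding V B)"
proof -
  let ?N = "{p \<in> avoiding V B. p i = j}"
  let ?M = "\<lambda>p. V - {k\<in>V. (i, p k) \<in> B} - {k\<in>V. (k, j) \<in> B}"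
  have M: "card V - a - b \<le> card (?M p)" if "p \<in> ?N" for p
  proof -
    have "card {k\<in>V. (i, p k) \<in> B} \<le> a"
      using that by (intro card_row_le[OF finite_V _ row[OF ij(1)]]) (auto simp: avoiding_def)
    moreover have "card {k\<in>V. (k, j) \<in> B} \<le> b" using col ij by simp
    moreover have "card V - card {k\<in>V. (i, p k) \<in> B} - card {k\<in>V. (k, j) \<in> B} \<le> card (?M p)"
      using diff_card_le_card_Diff[of "{k\<in>V. (i, p k) \<in> B}" V]
        diff_card_le_card_Diff[of "{k\<in>V. (k, j) \<in> B}" "V - {k\<in>V. (i, p k) \<in> B}"] finite_V
      by simp
    ultimately show ?thesis by linarith
  qed
  have "card ?N * (card V - a - b) = (\<Sum>p\<in>?N. card V - a - b)" by simp
  also have "\<dots> \<le> (\<Sum>p\<in>?N. card (?M p))" by (intro sum_mono M)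
  also have "\<dots> = card (Sigma ?N ?M)"
    using finite_V finite_avoiding[OF finite_V] by (subst card_SigmaI) auto
  also have "\<dots> \<le> card (avoiding V B)"
  proof (rule card_inj_on_le)
    show "inj_on (\<lambda>(p, k). p \<circ> Transposition.transpose i k) (Sigma ?N ?M)"
    proof (rule inj_onI)
      fix z w assume zw: "z \<in> Sigma ?N ?M" "w \<in> Sigma ?N ?M"
        "(\<lambda>(p, k). p \<circ> Transposition.transpose i k) z
          = (\<lambda>(p, k). p \<circ> Transposition.transpose i k) w"
      obtain p k q l where z: "z = (p, k)" and w: "w = (q, l)" by (cases z, cases w)
      have *: "p \<circ> Transposition.transpose i k = q \<circ> Transposition.transpose i l"
        "p \<in> avoiding V B" "q \<in> avoiding V B" "p i = j" "q i = p i"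
        using zw by (auto simp: z w)
      have pq: "p permutes V" "q permutes V" using * by (auto simp: avoiding_def)
      \<comment> \<open>Evaluating the equation at \<open>k\<close> gives
        \<open>p i = j = q i\<close> on its left side.\<close>
      have "(q \<circ> Transposition.transpose i l) k = q i" using *(1,5) by (metis comp_apply transpose_apply_second)
      hence "Transposition.transpose i l k = i" using permutes_inj[OF pq(2)] by (auto dest: injD)
      hence "k = l" by (auto simp: Transposition.transpose_def split: if_splits)
      moreover from this have "p = q"
        using *(1) by (metis comp_assoc comp_id transpose_comp_involutory)
      ultimately show "z = w" by (simp add: z w)
    qed
    show "(\<lambda>(p, k). p \<circ> Transposition.transpose i k) ` Sigma ?N ?M \<subseteq> avoiding V B"
      using ij by (auto intro!: avoiding_compose_transpose)
  qed (use finite_avoiding[OF finite_V] finite_V in auto)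
  finally show ?thesis .
qed

text \<open>
  The permutations counted on the left are those from which the reverse switching is impossible.
  Moving the preimage of \<open>j\<close> to another row \<open>m \<noteq> i\<close> keeps the image of \<open>i\<close>, so that the old preimage
  of \<open>j\<close> is one of at most \<open>b\<close> forbidden rows for that column. (\<open>inv\<close> is taken by HOL-Algebra here,
  hence \<open>inv_into UNIV\<close>.)
\<close>

lemma card_avoiding_bad:
  assumes ij: "i \<in> V" "j \<in> V" "(i, j) \<notin> B"
  shows "card {q \<in> avoiding V B. (inv_into UNIV q j, q i) \<in> B} * (card V - 1 - a - b)
    \<le> card (avoiding V B) * b"
proof -
  let ?N = "{q \<in> avoiding V B. (inv_into UNIV q j, q i) \<in> B}"
  \<comment> \<open>With \<open>k\<close> the preimage of \<open>j\<close>, moving it to row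
    \<open>m\<close> creates the cells \<open>(k, q m)\<close> and \<open>(m, j)\<close>; the last
    two sets removed are the \<open>m\<close> for which one of them is forbidden.\<close>
  let ?M = "\<lambda>q. V - {i} - {m\<in>V. (inv_into UNIV q j, q m) \<in> B} - {m\<in>V. (m, j) \<in> B}"
  let ?K = "\<lambda>q. {k\<in>V. (k, q i) \<in> B}"
  have inv_V: "inv_into UNIV q j \<in> V" if "q \<in> avoiding V B" for q
    using that ij by (auto simp: avoiding_def permutes_in_image[OF permutes_inv])
  have q_inv: "q (inv_into UNIV q j) = j" if "q \<in> avoiding V B" for q
    using that permutes_inverses by (auto simp: avoiding_def)
  have M: "card V - 1 - a - b \<le> card (?M p)" if "p \<in> ?N" for p
  proof -
    let ?R = "{m\<in>V. (inv_into UNIV p j, p m) \<in> B}"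
    have "card ?R \<le> a"
      using that by (intro card_row_le[OF finite_V _ row[OF inv_V]]) (auto simp: avoiding_def)
    moreover have "card {k\<in>V. (k, j) \<in> B} \<le> b" using col ij by simp
    moreover have "card (V - {i}) - card ?R - card {k\<in>V. (k, j) \<in> B} \<le> card (?M p)"
      using diff_card_le_card_Diff[of ?R "V - {i}"]
        diff_card_le_card_Diff[of "{k\<in>V. (k, j) \<in> B}" "V - {i} - ?R"] finite_V
      by simp
    moreover have "card (V - {i}) = card V - 1" using ij finite_V by simp
    ultimately show ?thesis by linarith
  qed
  have "card ?N * (card V - 1 - a - b) = (\<Sum>p\<in>?N. card V - 1 - a - b)" by simp
  also have "\<dots> \<le> (\<Sum>p\<in>?N. card (?M p))" by (intro sum_mono M)
  also have "\<dots> = card (Sigma ?N ?M)"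
    using finite_V finite_avoiding[OF finite_V] by (subst card_SigmaI) auto
  also have "\<dots> \<le> card (Sigma (avoiding V B) ?K)"
  proof (rule card_inj_on_le)
    \<comment> \<open>The second component keeps the old preimage of \<open>j\<close>: it fixes the
      transposition to be undone, and it belongs to \<open>?K\<close> of the new permutation because
      the image of \<open>i\<close> is unchanged.\<close>
    let ?f = "\<lambda>(q, m). (q \<circ> Transposition.transpose (inv_into UNIV q j) m, inv_into UNIV q j)"
    show "inj_on ?f (Sigma ?N ?M)"
    proof (rule inj_onI)
      fix z w assume zw: "z \<in> Sigma ?N ?M" "w \<in> Sigma ?N ?M" "?f z = ?f w"
      obtain p m q l where z: "z = (p, m)" and w: "w = (q, l)" by (cases z, cases w)
      have *: "p \<circ> Transposition.transpose (inv_into UNIV p j) m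
          = q \<circ> Transposition.transpose (inv_into UNIV q j) l"
        "inv_into UNIV p j = inv_into UNIV q j" "p \<in> avoiding V B" "q \<in> avoiding V B"
        using zw by (auto simp: z w)
      define k where "k = inv_into UNIV q j"
      have k: "p k = j" "q k = j" using q_inv[OF *(3)] q_inv[OF *(4)] *(2) by (auto simp: k_def)
      have e: "p \<circ> Transposition.transpose k m = q \<circ> Transposition.transpose k l" using * by (simp add: k_def)
      have pq: "p permutes V" "q permutes V" using * by (auto simp: avoiding_def)
      have "(q \<circ> Transposition.transpose k l) m = q k" using e k by (metis comp_apply transpose_apply_second)
      hence "Transposition.transpose k l m = k" using permutes_inj[OF pq(2)] by (auto dest: injD)
      hence "m = l" by (auto simp: Transposition.transpose_def split: if_splits)
      moreover from this have "p = q"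
        using e by (metis comp_assoc comp_id transpose_comp_involutory)
      ultimately show "z = w" by (simp add: z w)
    qed
    show "?f ` Sigma ?N ?M \<subseteq> Sigma (avoiding V B) ?K"
    proof (rule image_subsetI)
      fix z assume "z \<in> Sigma ?N ?M"
      then obtain q m where z: "z = (q, m)"
        and *: "q \<in> avoiding V B" "(inv_into UNIV q j, q i) \<in> B" "m \<in> V"
          "(inv_into UNIV q j, q m) \<notin> B" "(m, j) \<notin> B" "m \<noteq> i"
        by (cases z) auto
      \<comment> \<open>Otherwise \<open>q i = j\<close>, and the forbidden cell would be
        \<open>(i, j)\<close> itself, which is not in \<open>B\<close>.\<close>
      have "inv_into UNIV q j \<noteq> i" using q_inv[OF *(1)] * ij by auto
      hence "(inv_into UNIV q j, (q \<circ> Transposition.transpose (inv_into UNIV q j) m) i) \<in> B"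
        using * by (auto simp: Transposition.transpose_def)
      moreover have "q \<circ> Transposition.transpose (inv_into UNIV q j) m \<in> avoiding V B"
        using * inv_V[OF *(1)] q_inv[OF *(1)] by (intro avoiding_compose_transpose) auto
      moreover have "inv_into UNIV q j \<in> V" using inv_V[OF *(1)] .
      ultimately show "?f z \<in> Sigma (avoiding V B) ?K" by (simp add: z)
    qed
  qed (use finite_avoiding[OF finite_V] finite_V in auto)
  also have "\<dots> = (\<Sum>q\<in>avoiding V B. card (?K q))"
    using finite_V finite_avoiding[OF finite_V] by (subst card_SigmaI) auto
  also have "\<dots> \<le> (\<Sum>q\<in>avoiding V B. b)"
    using ij by (intro sum_mono col) (auto simp: avoiding_def permutes_in_image)
  finally show ?thesis by simp
qed

text \<open>Reverse switching: exchanging the images of \<open>i\<close> and of the preimage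
  \<open>k\<close> of \<open>j\<close> creates \<open>(i, j)\<close>, which is allowed, and
  \<open>(k, q i)\<close>. The result together with \<open>k\<close> determines \<open>q\<close>; if
  \<open>(k, q i)\<close> is forbidden, \<open>q\<close> is counted by the second summand.\<close>

lemma card_avoiding_through_lower:
  assumes ij: "i \<in> V" "j \<in> V" "(i, j) \<notin> B"
  shows "card (avoiding V B)
    \<le> card {p \<in> avoiding V B. p i = j} * card V + card {q \<in> avoiding V B. (inv_into UNIV q j, q i) \<in> B}"
proof -
  let ?N = "{p \<in> avoiding V B. p i = j}"
  let ?G = "{q \<in> avoiding V B. (inv_into UNIV q j, q i) \<notin> B}"
  let ?f = "\<lambda>q. (q \<circ> Transposition.transpose i (inv_into UNIV q j), inv_into UNIV q j)"
  have inv_V: "inv_into UNIV q j \<in> V" if "q \<in> avoiding V B" for q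
    using that ij by (auto simp: avoiding_def permutes_in_image[OF permutes_inv])
  have q_inv: "q (inv_into UNIV q j) = j" if "q \<in> avoiding V B" for q
    using that permutes_inverses by (auto simp: avoiding_def)
  have "card ?G \<le> card (?N \<times> V)"
  proof (rule card_inj_on_le)
    \<comment> \<open>Equal second components mean equal transpositions, which then cancel.\<close>
    show "inj_on ?f ?G"
      by (rule inj_onI) (metis (no_types, lifting) comp_assoc comp_id fst_conv snd_conv
          transpose_comp_involutory)
    show "?f ` ?G \<subseteq> ?N \<times> V"
    proof (clarify, intro conjI SigmaI CollectI)
      fix q assume q: "q \<in> avoiding V B" "(inv_into UNIV q j, q i) \<notin> B"
      show "q \<circ> Transposition.transpose i (inv_into UNIV q j) \<in> avoiding V B"
        using q ij inv_V[OF q(1)] q_inv[OF q(1)] by (intro avoiding_compose_transpose) auto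
      show "(q \<circ> Transposition.transpose i (inv_into UNIV q j)) i = j"
        using q_inv[OF q(1)] by simp
    qed (use inv_V in auto)
  qed (use finite_avoiding[OF finite_V] finite_V in auto)
  moreover have "avoiding V B = ?G \<union> {q \<in> avoiding V B. (inv_into UNIV q j, q i) \<in> B}" by auto
  then have "card (avoiding V B) \<le> card ?G + card {q \<in> avoiding V B. (inv_into UNIV q j, q i) \<in> B}"
    by (metis (no_types, lifting) card_Un_le)
  ultimately show ?thesis by (simp add: card_cartesian_product)
qed

text \<open>\<open>P\<close> is the probability that a random permutation avoiding \<open>B\<close>
  passes through \<open>(i, j)\<close>. One switching bounds it above by \<open>1 / (N - c)\<close>
  with \<open>c = a + b\<close>; the reverse one bounds it below, since the bad permutations are a
  proportion of at most \<open>2 * b / N\<close>.\<close>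

lemma avoiding_insert_ratio:
  assumes ij: "i \<in> V" "j \<in> V" "(i, j) \<notin> B"
    and small: "2 * (a + b + 1) \<le> card V" and pos: "avoiding V B \<noteq> {}"
  defines "N \<equiv> real (card V)"
  obtains P where
    "real (card (avoiding V (insert (i, j) B))) = real (card (avoiding V B)) * (1 - P)"
    "1 / N - 2 * real b / N\<^sup>2 \<le> P" "P \<le> 1 / N + 2 * real (a + b) / N\<^sup>2" "0 \<le> P" "P \<le> 2 / N"
proof -
  define A where "A = real (card (avoiding V B))"
  define A1 where "A1 = real (card {p \<in> avoiding V B. p i = j})"
  define A2 where "A2 = real (card {q \<in> avoiding V B. (inv_into UNIV q j, q i) \<in> B})"
  define c where "c = real (a + b)"
  have fin: "finite (avoiding V B)" using finite_V by (rule finite_avoiding)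
  have A: "A > 0" using pos fin by (simp add: A_def card_gt_0_iff)
  have N: "2 * (c + 1) \<le> N" using of_nat_mono[OF small, where 'a = real] by (simp add: N_def c_def)
  have c: "0 \<le> c" "real b \<le> c" by (auto simp: c_def)
  have bounds: "A1 * (N - c) \<le> A" "A2 * (N - 1 - c) \<le> A * b" "A \<le> A1 * N + A2"
  proof -
    \<comment> \<open>In this form the truncated differences of naturals become exact and pass to
      the reals.\<close>
    obtain m where m: "card V = m + a + b + 1"
      using small by (metis add.assoc add.commute le_Suc_ex mult_2 trans_le_add1)
    show "A1 * (N - c) \<le> A"
      using of_nat_mono[OF card_avoiding_through_upper[OF ij], where 'a = real]
      by (simp add: A1_def A_def N_def c_def m algebra_simps)
    show "A2 * (N - 1 - c) \<le> A * b"
      using of_nat_mono[OF card_avoiding_bad[OF ij], where 'a = real]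
      by (simp add: A2_def A_def N_def c_def m algebra_simps)
    show "A \<le> A1 * N + A2"
      using of_nat_mono[OF card_avoiding_through_lower[OF ij], where 'a = real]
      by (simp only: A1_def A_def A2_def N_def of_nat_add of_nat_mult)
  qed
  have "card (avoiding V (insert (i, j) B)) + card {p \<in> avoiding V B. p i = j} = card (avoiding V B)"
  proof -
    have "avoiding V B = avoiding V (insert (i, j) B) \<union> {p \<in> avoiding V B. p i = j}"
      using ij by (auto simp: avoiding_def)
    moreover have "avoiding V (insert (i, j) B) \<inter> {p \<in> avoiding V B. p i = j} = {}"
      using ij by (auto simp: avoiding_def)
    ultimately show ?thesis using fin
      by (metis (no_types, lifting) card_Un_disjoint finite_Un)
  qed
  hence eq: "real (card (avoiding V (insert (i, j) B))) = A - A1"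
    by (simp add: A_def A1_def)
  have up: "A1 / A \<le> 1 / (N - c)"
    using bounds(1) A N c by (simp add: field_simps)
  have "A2 / A \<le> b / (N - 1 - c)"
    using bounds(2) A N c by (simp add: field_simps)
  \<comment> \<open>\<open>2 * (c + 1) \<le> N\<close> says exactly that \<open>N - 1 - c\<close> is
    at least \<open>N / 2\<close>.\<close>
  also have "\<dots> \<le> b / (N / 2)"
    using N c by (intro divide_left_mono) auto
  finally have A2: "A2 / A \<le> 2 * b / N" by (simp add: mult.commute)
  have "1 \<le> A1 / A * N + A2 / A" using bounds(3) A by (simp add: field_simps)
  hence "(1 - 2 * b / N) / N \<le> A1 / A" using A2 N c by (simp add: pos_divide_le_eq)
  hence lo: "1 / N - 2 * b / N\<^sup>2 \<le> A1 / A"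
    by (simp add: diff_divide_distrib power2_eq_square)
  have "1 / (N - c) = 1 / N + c / (N * (N - c))" using N c by (simp add: field_simps)
  also have "c / (N * (N - c)) \<le> c / (N * (N / 2))"
    using N c by (intro divide_left_mono mult_left_mono) auto
  finally have up': "A1 / A \<le> 1 / N + 2 * c / N\<^sup>2"
    using up by (simp add: power2_eq_square mult.commute)
  have "1 / (N - c) \<le> 1 / (N / 2)" using N c by (intro divide_left_mono) auto
  hence up2: "A1 / A \<le> 2 / N" using up by simp
  show thesis
    by (rule that[of "A1 / A"])
      (use eq lo up' up2 A in \<open>auto simp: A_def[symmetric] c_def A1_def algebra_simps\<close>)
qed

end

section \<open>Forbidding the cells one at a time\<close>

text \<open>The proportion of avoiding permutations is a product of factors \<open>1 - P\<close>,
  one for each cell. Each \<open>ln (1 - P)\<close> differs from \<open>- 1 / N\<close> by at most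
  \<open>2 * (a + b) / N\<^sup>2\<close>, from the estimate of \<open>P\<close>, plus
  \<open>8 / N\<^sup>2\<close>, from the second-order term of the logarithm.\<close>

lemma ln_card_avoiding:
  assumes V: "finite V" and small: "2 * (a + b + 1) \<le> card V"
    and "B \<subseteq> V \<times> V"
    and "\<And>x. x \<in> V \<Longrightarrow> card {y\<in>V. (x, y) \<in> B} \<le> a"
    and "\<And>y. y \<in> V \<Longrightarrow> card {x\<in>V. (x, y) \<in> B} \<le> b"
  shows "avoiding V B \<noteq> {} \<and>
    \<bar>ln (real (card (avoiding V B)) / fact (card V)) + real (card B) / real (card V)\<bar>
      \<le> real (card B) * (2 * (a + b) + 8) / (real (card V))\<^sup>2"
proof -
  have "finite B" using assms(1,3) by (auto intro: finite_subset)
  from this assms(3-) show ?thesis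
  proof (induction B rule: finite_induct)
    case empty
    have "avoiding V {} = {p. p permutes V}" by (simp add: avoiding_def)
    moreover from this have "avoiding V {} \<noteq> {}" using permutes_id[of V] by (metis empty_iff mem_Collect_eq)
    ultimately show ?case using V by (simp add: card_permutations)
  next
    case (insert e B)
    obtain i j where e: "e = (i, j)" by force
    have ij: "i \<in> V" "j \<in> V" "(i, j) \<notin> B" using insert e by auto
    interpret bounded_cells V B a b
    proof
      fix x assume x: "x \<in> V"
      have "card {y\<in>V. (x, y) \<in> B} \<le> card {y\<in>V. (x, y) \<in> insert e B}"
        using V by (intro card_mono) auto
      thus "card {y\<in>V. (x, y) \<in> B} \<le> a" using insert.prems(2)[OF x] by linarith
      have "card {y\<in>V. (y, x) \<in> B} \<le> card {y\<in>V. (y, x) \<in> insert e B}"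
        using V by (intro card_mono) auto
      thus "card {y\<in>V. (y, x) \<in> B} \<le> b" using insert.prems(3)[OF x] by linarith
    qed (rule V)
    have IH: "avoiding V B \<noteq> {}"
      "\<bar>ln (real (card (avoiding V B)) / fact (card V)) + real (card B) / real (card V)\<bar>
      \<le> real (card B) * (2 * (a + b) + 8) / (real (card V))\<^sup>2"
      using insert.IH insert.prems(1) row col by auto
    define N where "N = real (card V)"
    obtain P where P:
      "real (card (avoiding V (insert (i, j) B))) = real (card (avoiding V B)) * (1 - P)"
      "1 / N - 2 * real b / N\<^sup>2 \<le> P" "P \<le> 1 / N + 2 * real (a + b) / N\<^sup>2" "0 \<le> P" "P \<le> 2 / N"
      using avoiding_insert_ratio[OF ij small IH(1)] unfolding N_def by metis
    \<comment> \<open>The new cell itself lies in column \<open>j\<close>. This forces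
      \<open>N \<ge> 4\<close> and hence \<open>P \<le> 1 / 2\<close>, the range in which the
      logarithm is estimated.\<close>
    have bpos: "b \<ge> 1"
    proof -
      have "card {x\<in>V. (x, j) \<in> insert e B} > 0"
        using V ij e by (subst card_gt_0_iff) auto
      thus ?thesis using insert.prems(3)[OF ij(2)] by linarith
    qed
    have N4: "N \<ge> 4" using small bpos by (simp add: N_def)
    have P2: "P \<le> 1 / 2" using P(5) frac_le[of 2 2 4 N] N4 by linarith
    have A: "real (card (avoiding V B)) > 0"
      using IH(1) finite_avoiding[OF V] by (simp add: card_gt_0_iff)
    have A': "real (card (avoiding V (insert e B))) > 0"
      using P(1) A P2 e by simp
    have "ln (real (card (avoiding V (insert e B))) / fact (card V))
      = ln (real (card (avoiding V B)) / fact (card V)) + ln (1 - P)"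
      using A P2 unfolding e P(1) by (subst ln_mult_pos[symmetric]) auto
    moreover have "ln (1 - P) \<le> - P" using ln_add_one_self_le_self2[of "- P"] P2 by simp
    moreover have "- P - 8 / N\<^sup>2 \<le> ln (1 - P)"
    proof -
      \<comment> \<open>With \<open>P \<le> 2 / N\<close>, the term \<open>2 * P\<^sup>2\<close> is
        at most \<open>8 / N\<^sup>2\<close>.\<close>
      have "- P - 2 * P\<^sup>2 \<le> ln (1 - P)" using P P2 by (intro ln_one_minus_pos_lower_bound)
      moreover have "P\<^sup>2 \<le> (2 / N)\<^sup>2" using P by (intro power_mono)
      ultimately show ?thesis by (simp add: power_divide)
    qed
    moreover have "2 * real b / N\<^sup>2 \<le> (2 * (a + b) + 8) / N\<^sup>2"
      by (intro divide_right_mono) auto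
    moreover have "2 * real (a + b) / N\<^sup>2 + 8 / N\<^sup>2 = (2 * (a + b) + 8) / N\<^sup>2"
      by (simp add: add_divide_distrib)
    moreover have "real (card (insert e B)) / N = real (card B) / N + 1 / N"
      using insert by (simp add: add_divide_distrib)
    moreover have "real (card (insert e B)) * (2 * (a + b) + 8) / N\<^sup>2
      = real (card B) * (2 * (a + b) + 8) / N\<^sup>2 + (2 * (a + b) + 8) / N\<^sup>2"
      using insert by (simp add: add_divide_distrib distrib_right)
    ultimately have "\<bar>ln (real (card (avoiding V (insert e B))) / fact (card V))
      + real (card (insert e B)) / N\<bar> \<le> real (card (insert e B)) * (2 * (a + b) + 8) / N\<^sup>2"
      using IH(2) P(2,3) unfolding N_def by (smt (verit))
    thus ?case using A' unfolding N_def by force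
  qed
qed

section \<open>Existence of matrices with given margins\<close>

text \<open>Induction on the total: lower one positive row sum and one positive column sum by 1, and
  put the missing unit back where they cross.\<close>

lemma nat_matrix_with_margins_exists:
  fixes s t :: "nat \<Rightarrow> nat"
  assumes "(\<Sum>i<n. s i) = (\<Sum>j<n. t j)"
  shows "\<exists>M :: nat \<Rightarrow> nat \<Rightarrow> nat. (\<forall>i<n. (\<Sum>j<n. M i j) = s i) \<and> (\<forall>j<n. (\<Sum>i<n. M i j) = t j)"
  using assms
proof (induction "\<Sum>i<n. s i" arbitrary: s t)
  case 0
  thus ?case by (intro exI[of _ "\<lambda>_ _. 0"]) auto
next
  case (Suc m)
  obtain i where i: "i < n" "s i > 0"
    using Suc.hyps(2) by (metis gr0I lessThan_iff nat.distinct(1) sum.neutral)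
  obtain j where j: "j < n" "t j > 0"
    using Suc.hyps(2) Suc.prems by (metis gr0I lessThan_iff nat.distinct(1) sum.neutral)
  have dec: "(\<Sum>x<n. (f(k := f k - 1)) x) = (\<Sum>x<n. f x) - 1" if "k < n" "f k > 0"
    for f :: "nat \<Rightarrow> nat" and k
    using that by (simp add: sum.remove[of "{..<n}" k])
  obtain M where M: "\<And>x. x < n \<Longrightarrow> (\<Sum>y<n. M x y) = (s(i := s i - 1)) x"
    "\<And>y. y < n \<Longrightarrow> (\<Sum>x<n. M x y) = (t(j := t j - 1)) y"
    using Suc.hyps(1)[of "s(i := s i - 1)" "t(j := t j - 1)"] dec[of i s] dec[of j t] i j
      Suc.hyps(2) Suc.prems by (metis diff_Suc_1)
  define M' where "M' = (\<lambda>x y. M x y + (if x = i \<and> y = j then 1 else (0::nat)))"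
  have "(\<Sum>y<n. if x = i \<and> y = j then 1 else (0::nat)) = (if x = i then 1 else 0)" for x
    using j by (cases "x = i") (auto simp: sum.delta)
  hence "(\<Sum>y<n. M' x y) = s x" if "x < n" for x
    using that M(1)[OF that] i by (auto simp: M'_def sum.distrib)
  moreover have "(\<Sum>x<n. if x = i \<and> y = j then 1 else (0::nat)) = (if y = j then 1 else 0)" for y
    using i by (cases "y = j") (auto simp: sum.delta)
  hence "(\<Sum>x<n. M' x y) = t y" if "y < n" for y
    using that M(2)[OF that] j by (auto simp: M'_def sum.distrib)
  ultimately show ?case by blast
qed

text \<open>
  A matrix of natural numbers with the given margins and least sum of squares is a 0-1 matrix: an
  entry \<open>M i j \<ge> 2\<close> could be moved, together with one unit of some cell \<open>(k, l)\<close>, to the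
  empty cells \<open>(i, l)\<close> and \<open>(k, j)\<close>; at most \<open>2 a b\<close> units lie in cells \<open>(k, l)\<close> that do not allow this.
\<close>

lemma zero_one_matrix_with_margins_exists:
  fixes s t :: "nat \<Rightarrow> nat"
  assumes sums: "(\<Sum>i<n. s i) = (\<Sum>j<n. t j)"
    and s: "\<And>i. i < n \<Longrightarrow> s i \<le> a" and t: "\<And>j. j < n \<Longrightarrow> t j \<le> b"
    and large: "2 * a * b < (\<Sum>i<n. s i)"
  shows "\<exists>M :: nat \<Rightarrow> nat \<Rightarrow> nat. (\<forall>i<n. \<forall>j<n. M i j \<le> 1) \<and>
    (\<forall>i<n. (\<Sum>j<n. M i j) = s i) \<and> (\<forall>j<n. (\<Sum>i<n. M i j) = t j)"
proof -
  define margins where "margins M \<longleftrightarrow>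
    (\<forall>i<n. (\<Sum>j<n. M i j) = s i) \<and> (\<forall>j<n. (\<Sum>i<n. M i j) = t j)" for M :: "nat \<Rightarrow> nat \<Rightarrow> nat"
  define Q where "Q M = (\<Sum>i<n. \<Sum>j<n. (M i j)\<^sup>2)" for M :: "nat \<Rightarrow> nat \<Rightarrow> nat"
  have "\<exists>M. margins M" using nat_matrix_with_margins_exists[OF sums] by (simp add: margins_def)
  then obtain M where M: "margins M" and min: "\<And>M'. margins M' \<Longrightarrow> Q M \<le> Q M'"
    using ex_has_least_nat[of margins _ Q] by metis
  have Ms: "(\<Sum>j<n. M i j) = s i" if "i < n" for i using M that by (simp add: margins_def)
  have Mt: "(\<Sum>i<n. M i j) = t j" if "j < n" for j using M that by (simp add: margins_def)
  have "M i j \<le> 1" if ij: "i < n" "j < n" for i j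
  proof (rule ccontr)
    assume big: "\<not> M i j \<le> 1"
    have "\<exists>k<n. \<exists>l<n. M k l \<ge> 1 \<and> M i l = 0 \<and> M k j = 0"
    proof (rule ccontr)
      assume neg: "\<not> ?thesis"
      have "(\<Sum>k<n. s k) = (\<Sum>k<n. \<Sum>l<n. M k l)" using Ms by simp
      \<comment> \<open>Each unit in a cell \<open>(k, l)\<close> is charged to a nonzero
        \<open>M i l\<close> or \<open>M k j\<close>. Summing the first kind over \<open>k\<close>
        first gives at most \<open>b * s i\<close>, the second kind over \<open>l\<close> first at
        most \<open>a * t j\<close>.\<close>
      also have "\<dots> \<le> (\<Sum>k<n. \<Sum>l<n. M k l * (M i l + M k j))"
      proof (intro sum_mono)
        fix k l assume "k \<in> {..<n}" "l \<in> {..<n}"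
        hence "M k l = 0 \<or> M i l + M k j \<ge> 1" using neg by (auto simp: Suc_le_eq)
        thus "M k l \<le> M k l * (M i l + M k j)" by auto
      qed
      also have "\<dots> = (\<Sum>k<n. \<Sum>l<n. M k l * M i l) + (\<Sum>k<n. \<Sum>l<n. M k l * M k j)"
        by (simp add: distrib_left sum.distrib)
      also have "(\<Sum>k<n. \<Sum>l<n. M k l * M i l) = (\<Sum>l<n. t l * M i l)"
        by (subst sum.swap) (simp add: sum_distrib_right[symmetric] Mt)
      also have "\<dots> \<le> (\<Sum>l<n. b * M i l)" using t by (intro sum_mono mult_right_mono) auto
      also have "\<dots> = b * s i" using ij by (simp add: sum_distrib_left[symmetric] Ms)
      also have "(\<Sum>k<n. \<Sum>l<n. M k l * M k j) = (\<Sum>k<n. s k * M k j)"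
        by (simp add: sum_distrib_right[symmetric] Ms)
      also have "\<dots> \<le> (\<Sum>k<n. a * M k j)" using s by (intro sum_mono mult_right_mono) auto
      also have "\<dots> = a * t j" using ij by (simp add: sum_distrib_left[symmetric] Mt)
      also have "b * s i + a * t j \<le> b * a + a * b"
        using s[OF ij(1)] t[OF ij(2)] by (intro add_mono mult_left_mono) auto
      finally show False using large by (simp add: algebra_simps)
    qed
    then obtain k l where kl: "k < n" "l < n" "M k l \<ge> 1" "M i l = 0" "M k j = 0" by blast
    have neq: "i \<noteq> k" "j \<noteq> l" using kl big by auto
    define d where "d p q c x y = (if x = p \<and> y = q then c else (0::nat))" for p q x y :: nat and c
    have d_row: "(\<Sum>y<n. d p q c x y) = (if x = p then c else 0)" if "q < n" for p q c x
      using that unfolding d_def by (cases "x = p") (auto simp: sum.delta)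
    have d_col: "(\<Sum>x<n. d p q c x y) = (if y = q then c else 0)" if "p < n" for p q c y
      using that unfolding d_def by (cases "y = q") (auto simp: sum.delta)
    define M' where "M' x y = M x y + d i l 1 x y + d k j 1 x y - d i j 1 x y - d k l 1 x y" for x y
    \<comment> \<open>Stated without subtraction, so that it can be summed in the naturals; nothing
      is truncated because the two lowered cells are distinct and nonzero.\<close>
    have M': "M' x y + d i j 1 x y + d k l 1 x y = M x y + d i l 1 x y + d k j 1 x y" for x y
    proof -
      have "d i j 1 x y + d k l 1 x y \<le> M x y"
        using kl(3) big neq by (simp add: d_def)
      thus ?thesis unfolding M'_def by linarith
    qed
    have "(\<Sum>y<n. M' x y) = s x" if x: "x < n" for x
    proof -
      have "(\<Sum>y<n. M' x y + d i j 1 x y + d k l 1 x y) = (\<Sum>y<n. M x y + d i l 1 x y + d k j 1 x y)"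
        by (simp only: M')
      thus ?thesis using x ij kl by (simp add: sum.distrib d_row Ms)
    qed
    moreover have "(\<Sum>x<n. M' x y) = t y" if y: "y < n" for y
    proof -
      have "(\<Sum>x<n. M' x y + d i j 1 x y + d k l 1 x y) = (\<Sum>x<n. M x y + d i l 1 x y + d k j 1 x y)"
        by (simp only: M')
      thus ?thesis using y ij kl by (simp add: sum.distrib d_col Mt)
    qed
    ultimately have "Q M \<le> Q M'" by (intro min) (simp add: margins_def)
    \<comment> \<open>Lowering an entry \<open>m\<close> lowers its square by
      \<open>2 * m - 1\<close>, while filling an empty cell raises it by 1.\<close>
    moreover have sq: "(M' x y)\<^sup>2 + d i j (2 * M i j - 1) x y + d k l (2 * M k l - 1) x y
      = (M x y)\<^sup>2 + d i l 1 x y + d k j 1 x y" for x y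
    proof -
      have dec: "(m - 1)\<^sup>2 + (2 * m - 1) = m\<^sup>2" if "m \<ge> 1" for m :: nat
        using that by (cases m) (auto simp: power2_eq_square)
      consider "x = i" "y = j" | "x = k" "y = l" | "x = i" "y = l" | "x = k" "y = j"
        | "(x \<noteq> i \<or> y \<noteq> j)" "(x \<noteq> k \<or> y \<noteq> l)" "(x \<noteq> i \<or> y \<noteq> l)" "(x \<noteq> k \<or> y \<noteq> j)"
        by blast
      thus ?thesis
      proof cases
        case 1
        thus ?thesis using neq big dec[of "M i j"] by (simp add: M'_def d_def)
      next
        case 2
        thus ?thesis using neq kl(3) dec[of "M k l"] by (simp add: M'_def d_def)
      next
        case 3
        thus ?thesis using neq kl(4) by (simp add: M'_def d_def)
      next
        case 4
        thus ?thesis using neq kl(5) by (simp add: M'_def d_def)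
      next
        case 5
        hence "d i j c x y = 0" "d k l c x y = 0" "d i l c x y = 0" "d k j c x y = 0" for c
          by (auto simp: d_def)
        thus ?thesis by (simp add: M'_def)
      qed
    qed
    have "(\<Sum>x<n. \<Sum>y<n. (M' x y)\<^sup>2 + d i j (2 * M i j - 1) x y + d k l (2 * M k l - 1) x y)
      = (\<Sum>x<n. \<Sum>y<n. (M x y)\<^sup>2 + d i l 1 x y + d k j 1 x y)"
      by (simp only: sq)
    \<comment> \<open>The loss is at least 3 + 1 and the gain is 2, against minimality.\<close>
    hence "Q M' + (2 * M i j - 1) + (2 * M k l - 1) = Q M + 1 + 1"
      using ij kl by (simp add: sum.distrib d_row Q_def)
    ultimately show False using big kl(3) by linarith
  qed
  thus ?thesis using M unfolding margins_def by blast
qed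

section \<open>Permanents of the matrices and their average\<close>

lemma finite_matrices_with_complementary_sums: "finite (matrices_with_complementary_sums n s t)"
proof (rule inj_on_finite)
  let ?f = "\<lambda>A :: real mat. {(i, j) \<in> {..<n} \<times> {..<n}. A $$ (i, j) = 1}"
  show "inj_on ?f (matrices_with_complementary_sums n s t)"
  proof (rule inj_onI)
    fix A C assume A: "A \<in> matrices_with_complementary_sums n s t"
      and C: "C \<in> matrices_with_complementary_sums n s t" and eq: "?f A = ?f C"
    show "A = C"
    proof (rule eq_matI)
      fix i j assume "i < dim_row C" "j < dim_col C"
      hence ij: "i < n" "j < n" using C by (auto simp: matrices_with_complementary_sums_def)
      have "A $$ (i, j) = 1 \<longleftrightarrow> C $$ (i, j) = 1" using eq ij by blast
      moreover have "A $$ (i, j) \<in> {0, 1}" "C $$ (i, j) \<in> {0, 1}"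
        using A C ij by (auto simp: matrices_with_complementary_sums_def)
      ultimately show "A $$ (i, j) = C $$ (i, j)" by auto
    qed (use A C in \<open>auto simp: matrices_with_complementary_sums_def\<close>)
  qed
  show "?f ` matrices_with_complementary_sums n s t \<subseteq> Pow ({..<n} \<times> {..<n})" by auto
qed simp

text \<open>Complementing a 0-1 matrix with margins \<open>s\<close> and \<open>t\<close> gives a
  member. Nonemptiness makes the uniform distribution in \<open>expected_permanent\<close> a genuine
  one.\<close>

lemma matrices_with_complementary_sums_nonempty:
  assumes len: "length s = n" "length t = n" and sums: "sum_list s = sum_list t"
    and s: "\<And>x. x \<in> set s \<Longrightarrow> x \<le> a" and t: "\<And>x. x \<in> set t \<Longrightarrow> x \<le> b"
    and large: "2 * a * b < sum_list s"
  shows "matrices_with_complementary_sums n s t \<noteq> {}"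
proof -
  have S: "(\<Sum>i<n. s ! i) = sum_list s" "(\<Sum>i<n. t ! i) = sum_list t"
    using len by (auto simp: sum_list_sum_nth atLeast0LessThan)
  have "\<exists>M :: nat \<Rightarrow> nat \<Rightarrow> nat. (\<forall>i<n. \<forall>j<n. M i j \<le> 1) \<and>
    (\<forall>i<n. (\<Sum>j<n. M i j) = s ! i) \<and> (\<forall>j<n. (\<Sum>i<n. M i j) = t ! j)"
    using sums s t large len by (intro zero_one_matrix_with_margins_exists[of _ _ _ a b]) (auto simp: S)
  then obtain M :: "nat \<Rightarrow> nat \<Rightarrow> nat" where M: "\<And>i j. i < n \<Longrightarrow> j < n \<Longrightarrow> M i j \<le> 1"
    "\<And>i. i < n \<Longrightarrow> (\<Sum>j<n. M i j) = s ! i" "\<And>j. j < n \<Longrightarrow> (\<Sum>i<n. M i j) = t ! j"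
    by blast
  define A where "A = mat n n (\<lambda>(i, j). 1 - real (M i j))"
  have "A \<in> matrices_with_complementary_sums n s t"
    unfolding matrices_with_complementary_sums_def
  proof (intro CollectI conjI allI impI)
    show "A \<in> carrier_mat n n" by (simp add: A_def)
    show "A $$ (i, j) \<in> {0, 1}" if "i < n" "j < n" for i j
      using M(1)[OF that] that by (auto simp: A_def le_Suc_eq)
    show "(\<Sum>j<n. A $$ (i, j)) = real n - real (s ! i)" if "i < n" for i
      using that by (simp add: A_def sum_subtractf M(2)[symmetric])
    show "(\<Sum>i<n. A $$ (i, j)) = real n - real (t ! j)" if "j < n" for j
      using that by (simp add: A_def sum_subtractf M(3)[symmetric])
  qed
  thus ?thesis by blast
qed

text \<open>The product along a permutation is 1 if it meets no zero entry and 0 otherwise.\<close>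

lemma permanent_zero_one:
  fixes A :: "'a :: {comm_semiring_1, semiring_char_0} mat"
  assumes "dim_row A = n" "\<And>i j. i < n \<Longrightarrow> j < n \<Longrightarrow> A $$ (i, j) \<in> {0, 1}"
  shows "permanent A = of_nat (card (avoiding {..<n} {(i, j). A $$ (i, j) = 0}))"
proof -
  have "(\<Prod>i<n. A $$ (i, p i)) = (if \<forall>i<n. A $$ (i, p i) \<noteq> 0 then 1 else 0)"
    if "p permutes {..<n}" for p
  proof (cases "\<forall>i<n. A $$ (i, p i) \<noteq> 0")
    case True
    hence "A $$ (i, p i) = 1" if "i < n" for i
      using that assms(2)[of i "p i"] permutes_in_image[OF \<open>p permutes _\<close>, of i] by auto
    thus ?thesis using True by simp
  next
    case False
    thus ?thesis by (auto intro!: prod_zero)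
  qed
  hence "permanent A = (\<Sum>p | p permutes {..<n}. if \<forall>i<n. A $$ (i, p i) \<noteq> 0 then 1 else 0)"
    using assms(1) by (simp add: permanent_def atLeast0LessThan)
  also have "\<dots> = of_nat (card {p. p permutes {..<n} \<and> (\<forall>i<n. A $$ (i, p i) \<noteq> 0)})"
    using finite_permutations[of "{..<n}"] by (simp add: sum.If_cases Int_def)
  finally show ?thesis by (simp add: avoiding_def Ball_def)
qed

text \<open>Lets the zero set of a matrix be cut down to valid indices, as counting its cells
  requires.\<close>

lemma avoiding_Int: "avoiding V (B \<inter> V \<times> V) = avoiding V B"
  by (auto simp: avoiding_def permutes_in_image)

text \<open>The zeros of \<open>A\<close> number \<open>s ! x\<close> in row \<open>x\<close> and
  \<open>t ! y\<close> in column \<open>y\<close>, hence \<open>S\<close> in all, so every such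
  matrix obeys the same estimate.\<close>

lemma permanent_bounds:
  assumes A: "A \<in> matrices_with_complementary_sums n s t"
    and len: "length s = n" "length t = n"
    and s: "\<And>x. x \<in> set s \<Longrightarrow> x \<le> a" and t: "\<And>x. x \<in> set t \<Longrightarrow> x \<le> b"
    and small: "2 * (a + b + 1) \<le> n"
  defines "S \<equiv> real (sum_list s)"
  shows "permanent A > 0 \<and>
    \<bar>ln (permanent A / fact n) + S / n\<bar> \<le> S * (2 * (a + b) + 8) / n\<^sup>2"
proof -
  let ?V = "{..<n}"
  define B where "B = {(i, j). A $$ (i, j) = 0} \<inter> ?V \<times> ?V"
  have ent: "A $$ (i, j) \<in> {0, 1}" if "i < n" "j < n" for i j
    using A that by (auto simp: matrices_with_complementary_sums_def)
  have zeros: "real (card {x\<in>?V. f x = 0}) = n - (\<Sum>x<n. f x)"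
    if "\<And>x. x < n \<Longrightarrow> f x \<in> {0, 1}" for f :: "nat \<Rightarrow> real"
  proof -
    have "(\<Sum>x<n. 1 - f x) = (\<Sum>x<n. if f x = 0 then 1 else 0)"
      using that by (intro sum.cong) auto
    thus ?thesis by (simp add: sum_subtractf sum.If_cases Int_def)
  qed
  have row: "card {y\<in>?V. (x, y) \<in> B} = s ! x" if "x < n" for x
  proof -
    have "{y\<in>?V. (x, y) \<in> B} = {y\<in>?V. A $$ (x, y) = 0}" using that by (auto simp: B_def)
    moreover have "(\<Sum>y<n. A $$ (x, y)) = real n - real (s ! x)"
      using A that by (auto simp: matrices_with_complementary_sums_def)
    ultimately show ?thesis using zeros[of "\<lambda>y. A $$ (x, y)"] ent that by simp
  qed
  have col: "card {x\<in>?V. (x, y) \<in> B} = t ! y" if "y < n" for y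
  proof -
    have "{x\<in>?V. (x, y) \<in> B} = {x\<in>?V. A $$ (x, y) = 0}" using that by (auto simp: B_def)
    moreover have "(\<Sum>x<n. A $$ (x, y)) = real n - real (t ! y)"
      using A that by (auto simp: matrices_with_complementary_sums_def)
    ultimately show ?thesis using zeros[of "\<lambda>x. A $$ (x, y)"] ent that by simp
  qed
  have "B = Sigma ?V (\<lambda>x. {y\<in>?V. (x, y) \<in> B})" by (auto simp: B_def)
  hence "card B = card (Sigma ?V (\<lambda>x. {y\<in>?V. (x, y) \<in> B}))" by (rule arg_cong)
  also have "\<dots> = (\<Sum>x<n. card {y\<in>?V. (x, y) \<in> B})" by (rule card_SigmaI) auto
  also have "\<dots> = (\<Sum>x<n. s ! x)" by (intro sum.cong refl row) simp
  also have "\<dots> = sum_list s" using len by (simp add: sum_list_sum_nth atLeast0LessThan)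
  finally have card_B: "card B = sum_list s" .
  have perm: "permanent A = card (avoiding ?V B)"
    using A ent unfolding B_def avoiding_Int
    by (subst permanent_zero_one) (auto simp: matrices_with_complementary_sums_def)
  have "avoiding ?V B \<noteq> {} \<and>
    \<bar>ln (real (card (avoiding ?V B)) / fact (card ?V)) + real (card B) / real (card ?V)\<bar>
      \<le> real (card B) * (2 * (a + b) + 8) / (real (card ?V))\<^sup>2"
  proof (rule ln_card_avoiding)
    show "card {y\<in>?V. (x, y) \<in> B} \<le> a" if "x \<in> ?V" for x
      using that row[of x] s[OF nth_mem, of x] len by simp
    show "card {x\<in>?V. (x, y) \<in> B} \<le> b" if "y \<in> ?V" for y
      using that col[of y] t[OF nth_mem, of y] len by simp
  qed (use small in \<open>auto simp: B_def\<close>)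
  thus ?thesis using finite_avoiding[of ?V B]
    by (simp add: perm card_B S_def card_gt_0_iff)
qed

text \<open>The estimate for a single matrix is uniform: all permanents lie between the same
  \<open>L\<close> and \<open>U\<close>, and so does their average.\<close>

lemma expected_permanent_bounds:
  assumes len: "length s = n" "length t = n" and sums: "sum_list s = sum_list t"
    and s: "\<And>x. x \<in> set s \<Longrightarrow> x \<le> a" and t: "\<And>x. x \<in> set t \<Longrightarrow> x \<le> b"
    and small: "2 * (a + b + 1) \<le> n" and large: "2 * a * b < sum_list s"
  defines "S \<equiv> real (sum_list s)"
  shows "expected_permanent n s t > 0 \<and>
    \<bar>ln (expected_permanent n s t / fact n) + S / n\<bar> \<le> S * (2 * (a + b) + 8) / n\<^sup>2"
proof -
  let ?X = "matrices_with_complementary_sums n s t"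
  let ?\<delta> = "S * (2 * (a + b) + 8) / n\<^sup>2"
  define L where "L = fact n * exp (- (S / n) - ?\<delta>)"
  define U where "U = fact n * exp (- (S / n) + ?\<delta>)"
  have fin: "finite ?X" by (rule finite_matrices_with_complementary_sums)
  have ne: "?X \<noteq> {}" using assms by (intro matrices_with_complementary_sums_nonempty) auto
  have E: "expected_permanent n s t = (\<Sum>A\<in>?X. permanent A) / card ?X"
    unfolding expected_permanent_def using fin ne by (simp add: integral_pmf_of_set)
  have per: "L \<le> permanent A \<and> permanent A \<le> U" if "A \<in> ?X" for A
  proof -
    have pos: "permanent A > 0"
      and *: "\<bar>ln (permanent A / fact n) + S / n\<bar> \<le> ?\<delta>"
      using permanent_bounds[OF that len s t small] unfolding S_def by auto
    have "permanent A = fact n * exp (ln (permanent A / fact n))" using pos by simp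
    thus ?thesis using * unfolding L_def U_def
      by (smt (verit) exp_le_cancel_iff fact_gt_zero mult_left_mono)
  qed
  have card: "real (card ?X) > 0" using fin ne by (simp add: card_gt_0_iff)
  have "card ?X * L \<le> (\<Sum>A\<in>?X. permanent A)" "(\<Sum>A\<in>?X. permanent A) \<le> card ?X * U"
    using per by (auto intro: sum_bounded_below sum_bounded_above)
  hence LU: "L \<le> expected_permanent n s t" "expected_permanent n s t \<le> U"
    using card by (auto simp: E field_simps)
  have L: "L > 0" by (simp add: L_def)
  have "ln (L / fact n) \<le> ln (expected_permanent n s t / fact n)"
    "ln (expected_permanent n s t / fact n) \<le> ln (U / fact n)"
    using LU L by (auto intro!: ln_mono divide_right_mono)
  moreover have "expected_permanent n s t > 0" using LU L by linarith
  ultimately show ?thesis by (auto simp: L_def U_def)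
qed

section \<open>The error term and the limit\<close>

text \<open>The mean margin \<open>x = S / n\<close> is at most both \<open>a\<close> and
  \<open>b\<close>. Hence \<open>x \<le> sqrt (a * b)\<close> and
  \<open>x * (a + b) \<le> 2 * (a * b)\<close>, whose product supplies the power 3/2.\<close>

lemma error_term_bound:
  fixes S n a b :: real
  assumes "S > 0" "n > 0" "1 \<le> a" "1 \<le> b" "S \<le> n * a" "S \<le> n * b"
  shows "S * (2 * (a + b) + 8) / n\<^sup>2 \<le> 12 * (a powr (3 / 2) * b powr (3 / 2) / S)"
proof -
  define x where "x = S / n"
  have x: "0 < x" "x \<le> a" "x \<le> b" using assms by (auto simp: x_def field_simps)
  have "x = sqrt (x * x)" using x by simp
  also have "\<dots> \<le> sqrt (a * b)" using x by (intro real_sqrt_le_mono mult_mono) auto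
  finally have xs: "x \<le> sqrt (a * b)" .
  have "x * (x * (a + b)) \<le> sqrt (a * b) * (2 * (a * b))"
  proof (rule mult_mono[OF xs])
    have "x * a \<le> b * a" "x * b \<le> a * b" using x assms by (auto intro: mult_right_mono)
    thus "x * (a + b) \<le> 2 * (a * b)" by (simp add: algebra_simps)
  qed (use x assms in auto)
  also have "\<dots> = 2 * (a * b) powr (3 / 2)"
    using assms powr_add[of "a * b" 1 "1 / 2"] by (simp add: powr_half_sqrt)
  also have "\<dots> = 2 * (a powr (3 / 2) * b powr (3 / 2))"
    using assms by (simp add: powr_mult)
  finally have *: "x * x * (a + b) \<le> 2 * (a powr (3 / 2) * b powr (3 / 2))" by (simp add: mult.assoc)
  have "S * (2 * (a + b) + 8) / n\<^sup>2 = x * x * (2 * (a + b) + 8) / S"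
    using assms by (simp add: x_def power2_eq_square)
  \<comment> \<open>\<open>8 \<le> 4 * (a + b)\<close>, since \<open>a\<close> and \<open>b\<close>
    are at least 1.\<close>
  also have "\<dots> \<le> x * x * (6 * (a + b)) / S"
    using assms x by (intro divide_right_mono mult_left_mono) auto
  also have "\<dots> \<le> 12 * (a powr (3 / 2) * b powr (3 / 2)) / S"
    using * assms by (intro divide_right_mono) (auto simp: algebra_simps)
  finally show ?thesis by simp
qed

theorem theorem4p3:
  fixes n S :: "'i \<Rightarrow> nat" and s t :: "'i \<Rightarrow> nat list"
  assumes "\<forall>i. length (s i) = n i" and "\<forall>i. length (t i) = n i"
    and "\<forall>i. sum_list (s i) = S i" and "\<forall>i. sum_list (t i) = S i"
    and "(\<lambda>i. real (Max (set (s i))) * real (Max (set (t i))))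
           \<in> o[filtercomap S at_top](\<lambda>i. real (S i) powr (2 / 3))"
    and "\<exists>c>0. \<forall>i. real (S i) \<ge> c * real (n i)"
  shows "\<exists>e. e \<in> O[filtercomap S at_top](\<lambda>i.
                   real (Max (set (s i))) powr (3 / 2) * real (Max (set (t i))) powr (3 / 2)
                     / real (S i)) \<and>
             (\<forall>\<^sub>F i in filtercomap S at_top.
                expected_permanent (n i) (s i) (t i)
                  = fact (n i) * exp (- (real (S i) / real (n i)) + e i))"
proof -
  define a where "a i = Max (set (s i))" for i
  define b where "b i = Max (set (t i))" for i
  \<comment> \<open>The claimed formula solved for its error term; it then holds wherever the
    expectation is positive.\<close>
  define e where "e i = ln (expected_permanent (n i) (s i) (t i) / fact (n i)) + real (S i) / n i" for i
  \<comment> \<open>The constant 1/12 yields \<open>12 * a i * b i \<le> S i\<close>. With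
    \<open>S i\<close> at most \<open>n i * b i\<close> and \<open>n i * a i\<close>, both maxima
    are at most \<open>n i / 12\<close>, which covers both size conditions of the finite
    estimate.\<close>
  have key: "expected_permanent (n i) (s i) (t i) > 0 \<and>
      \<bar>e i\<bar> \<le> 12 * (real (a i) powr (3 / 2) * real (b i) powr (3 / 2) / S i)"
    if Si: "S i \<ge> 1" and ab: "real (a i) * real (b i) \<le> 1 / 12 * real (S i) powr (2 / 3)" for i
  proof -
    have le: "x \<le> a i" if "x \<in> set (s i)" for x using that by (simp add: a_def)
    have le': "x \<le> b i" if "x \<in> set (t i)" for x using that by (simp add: b_def)
    have sa: "S i \<le> n i * a i"
      using assms(1,3) sum_list_mono[of "s i" "\<lambda>x. x" "\<lambda>_. a i"] le
      by (simp add: sum_list_triv)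
    have sb: "S i \<le> n i * b i"
      using assms(2,4) sum_list_mono[of "t i" "\<lambda>x. x" "\<lambda>_. b i"] le'
      by (simp add: sum_list_triv)
    \<comment> \<open>\<open>S i \<ge> 1\<close> excludes empty lists, for which \<open>Max\<close>
      would be unspecified.\<close>
    have pos: "a i \<ge> 1" "b i \<ge> 1" "n i \<ge> 1"
      using sa sb Si by (metis One_nat_def Suc_leI bot_nat_0.extremum_uniqueI gr0I mult_0 mult_0_right
          not_one_le_zero)+
    have "real (S i) powr (2 / 3) \<le> real (S i) powr 1" using Si by (intro powr_mono) auto
    hence ab12: "12 * (real (a i) * real (b i)) \<le> real (S i)" using ab Si by simp
    hence N: "12 * (a i * b i) \<le> S i" by (metis of_nat_le_iff of_nat_mult of_nat_numeral)
    have "12 * a i * b i \<le> n i * b i" using N sb by linarith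
    hence an: "12 * a i \<le> n i" using pos by simp
    have "12 * b i * a i \<le> n i * a i" using N sa unfolding mult.assoc mult.commute[of "b i"] by linarith
    hence bn: "12 * b i \<le> n i" using pos by simp
    have "2 * a i * b i < S i" using N Si unfolding mult.assoc by linarith
    moreover have "2 * (a i + b i + 1) \<le> n i" using an bn pos by simp
    moreover have "length (s i) = n i" "length (t i) = n i" "sum_list (s i) = S i" "sum_list (t i) = S i"
      using assms(1-4) by blast+
    ultimately have "expected_permanent (n i) (s i) (t i) > 0 \<and>
        \<bar>e i\<bar> \<le> real (S i) * real (2 * (a i + b i) + 8) / real ((n i)\<^sup>2)"
      using expected_permanent_bounds[of "s i" "n i" "t i" "a i" "b i", OF _ _ _ le le']
      unfolding e_def by simp
    moreover have "real (S i) * (2 * (real (a i) + real (b i)) + 8) / (real (n i))\<^sup>2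
      \<le> 12 * (real (a i) powr (3 / 2) * real (b i) powr (3 / 2) / S i)"
    proof (rule error_term_bound)
      show "real (S i) \<le> real (n i) * real (a i)" "real (S i) \<le> real (n i) * real (b i)"
        using sa sb by (metis of_nat_le_iff of_nat_mult)+
    qed (use pos Si in auto)
    ultimately show ?thesis by simp
  qed
  have "\<forall>\<^sub>F i in filtercomap S at_top. S i \<ge> 1"
    using eventually_filtercomapI[OF eventually_ge_at_top[of 1]] .
  moreover have "\<forall>\<^sub>F i in filtercomap S at_top.
      real (a i) * real (b i) \<le> 1 / 12 * real (S i) powr (2 / 3)"
    using landau_o.smallD[OF assms(5), of "1 / 12"] by (simp add: a_def b_def)
  ultimately have ev: "\<forall>\<^sub>F i in filtercomap S at_top. expected_permanent (n i) (s i) (t i) > 0 \<and>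
      \<bar>e i\<bar> \<le> 12 * (real (a i) powr (3 / 2) * real (b i) powr (3 / 2) / S i)"
    by eventually_elim (rule key)
  have "e \<in> O[filtercomap S at_top](\<lambda>i. real (a i) powr (3 / 2) * real (b i) powr (3 / 2) / S i)"
    by (rule bigoI[of _ 12]) (use ev in \<open>eventually_elim, simp\<close>)
  moreover have "\<forall>\<^sub>F i in filtercomap S at_top.
      expected_permanent (n i) (s i) (t i) = fact (n i) * exp (- (real (S i) / real (n i)) + e i)"
    using ev by eventually_elim (simp add: e_def)
  ultimately show ?thesis unfolding a_def b_def by blast
qed

end
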